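(* Let $0\le\kappa<1$. For every $\varepsilon>0$ there are a $2\pi$-periodic potential $V$ and a nonzero bounded $2\pi$-periodic solution $u$ of $$\log(e+|D|)u=Vu$$ such that, for some constants $C,A>0$, $$\|V^{(m)}\|_{L^\infty(\mathbb T)}\le CA^m(m!)^\kappa,\qquad m=0,1,2,\dots,$$ but no constants $B,C_1<\infty$ can make $$\|u^{(m)}\|_{L^\infty(\mathbb T)}\le C_1B^m\frac{m!}{\big(\log(e+\log(e+m))\big)^{(1-\kappa+\varepsilon)m}},\qquad m=0,1,2,\dots .$$
   Context: $\mathbb T=\mathbb R/2\pi\mathbb Z$; functions on $\mathbb T$ are complex-valued. $\log(e+|D|)$ acts by $\log(e+|D|)e^{inx}=\log(e+|n|)e^{inx}$, $n\in\mathbb Z$. $V^{(m)},u^{(m)}$ denote $m$-th derivatives. *)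

theory Defs
  imports "HOL-Analysis.Analysis" "HOL-Probability.Essential_Supremum"
begin

text \<open>
  Functions on the torus \<open>\<real>/2\<pi>\<int>\<close> are represented by functions \<open>\<real> \<Rightarrow> \<complex>\<close> of period \<open>2\<pi>\<close>.
\<close>

definition periodic_2pi :: "(real \<Rightarrow> complex) \<Rightarrow> bool" where
  "periodic_2pi f \<longleftrightarrow> (\<forall>x. f (x + 2 * pi) = f x)"

primrec nth_vderiv :: "nat \<Rightarrow> (real \<Rightarrow> complex) \<Rightarrow> real \<Rightarrow> complex" where
  "nth_vderiv 0 f = f"
| "nth_vderiv (Suc m) f = (\<lambda>x. vector_derivative (nth_vderiv m f) (at x))"

definition smooth :: "(real \<Rightarrow> complex) \<Rightarrow> bool" where
  "smooth f \<longleftrightarrow> (\<forall>m x. nth_vderiv m f differentiable (at x))"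

definition Linf_norm :: "(real \<Rightarrow> complex) \<Rightarrow> ereal" where
  "Linf_norm f = esssup (lebesgue_on {0..2 * pi}) (\<lambda>x. ereal (norm (f x)))"

definition fourier_coeff :: "(real \<Rightarrow> complex) \<Rightarrow> int \<Rightarrow> complex" where
  "fourier_coeff f n =
     (1 / (2 * pi)) *\<^sub>R (LINT x|lebesgue_on {0..2 * pi}. f x * cis (- (real_of_int n * x)))"

text \<open>
  \<open>log_D_eq u w\<close> says \<open>log(e + |D|) u = w\<close>. For an integrable \<open>u\<close> the left-hand side is in
  general only a periodic distribution, determined by its Fourier coefficients
  \<open>log(e + |n|) \<cdot> \<hat>u(n)\<close>; the equation is therefore an equality of Fourier coefficients.
\<close>

definition log_D_eq :: "(real \<Rightarrow> complex) \<Rightarrow> (real \<Rightarrow> complex) \<Rightarrow> bool" where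
  "log_D_eq u w \<longleftrightarrow>
     u absolutely_integrable_on {0..2 * pi} \<and> w absolutely_integrable_on {0..2 * pi} \<and>
     (\<forall>n. of_real (ln (exp 1 + \<bar>real_of_int n\<bar>)) * fourier_coeff u n = fourier_coeff w n)"

lemma log_D_eq_character:
  "log_D_eq (\<lambda>x. cis (real_of_int k * x))
     (\<lambda>x. of_real (ln (exp 1 + \<bar>real_of_int k\<bar>)) * cis (real_of_int k * x))"
proof -
  let ?I = "{0..2 * pi}" and ?c = "\<lambda>x. cis (real_of_int k * x)"
  let ?l = "\<lambda>n::int. complex_of_real (ln (exp 1 + \<bar>real_of_int n\<bar>))"
  have int: "(\<lambda>x. a * ?c x) absolutely_integrable_on ?I" for a
    by (intro absolutely_integrable_continuous_real continuous_intros)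
  have zero: "fourier_coeff ?c n = 0" if "n \<noteq> k" for n
  proof -
    define j where "j = real_of_int (k - n)"
    have j: "j \<noteq> 0" using that by (simp add: j_def)
    let ?F = "\<lambda>x. cis (j * x) / (\<i> * of_real j)"
    have "((\<lambda>x. cis (j * x)) has_integral ?F (2 * pi) - ?F 0) ?I"
      by (rule fundamental_theorem_of_calculus)
        (use j in \<open>auto simp: cis_conv_exp field_simps
           intro!: derivative_eq_intros has_vector_derivative_real_field\<close>)
    moreover have "cis (j * (2 * pi)) = 1"
      using cis_multiple_2pi[of "j"] by (simp add: j_def mult_ac)
    ultimately have "((\<lambda>x. cis (j * x)) has_integral 0) ?I" by simp
    moreover have "integrable (lebesgue_on ?I) (\<lambda>x. cis (j * x))"
      by (intro continuous_imp_integrable_real continuous_intros)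
    ultimately have "(LINT x|lebesgue_on ?I. cis (j * x)) = 0"
      by (simp add: lebesgue_integral_eq_integral integral_unique)
    moreover have "?c x * cis (- (real_of_int n * x)) = cis (j * x)" for x
      by (simp add: cis_mult j_def algebra_simps)
    ultimately show ?thesis by (simp add: fourier_coeff_def)
  qed
  have scale: "fourier_coeff (\<lambda>x. a * ?c x) n = a * fourier_coeff ?c n" for a n
    by (simp add: fourier_coeff_def mult.assoc)
  have "?l n * fourier_coeff ?c n = fourier_coeff (\<lambda>x. ?l k * ?c x) n" for n
    unfolding scale by (cases "n = k") (simp_all add: zero)
  then show ?thesis
    unfolding log_D_eq_def using int[of 1] int by simp
qed

end

theory Submission
  imports Defs "HOL-Real_Asymp.Real_Asymp"
begin

text \<open>
  Let \<open>L n = log (e + n)\<close> and seek a potential \<open>V = 1 + (\<Sum>k\<ge>1. w k e^(ikx))\<close> and a solution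
  \<open>u = (\<Sum>n\<ge>0. a n e^(inx))\<close> with nonnegative frequencies only. Then the equation reads
  \<open>(L n - 1) * a n = (\<Sum>1\<le>k\<le>n. w k * a (n - k))\<close>. Because \<open>L 0 = 1\<close>, it leaves \<open>a 0 = 1\<close> free and
  determines all other coefficients recursively: complex-valued potentials make the equation
  triangular. For \<open>w k \<ge> 0\<close> all \<open>a n\<close> are nonnegative, and no cancellation can occur.

  The choice \<open>w k = exp (- k^(1/\<kappa>))\<close> (for \<open>\<kappa> = 0\<close>: only the frequencies \<open>0\<close> and \<open>1\<close>) gives the
  Gevrey bound on \<open>V\<close>; this is \<open>power_gevrey_coeff_le\<close>. Since \<open>L n\<close> tends to infinity, the
  recursion preserves exponential decay, so \<open>u\<close> is smooth (\<open>solution_coeff_exp_bound\<close>) and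
  solves the equation (\<open>log_D_eq_fourier_series\<close>).

  The decay of \<open>a\<close> cannot be much better than exponential. Keeping only the term with a fixed step
  \<open>k\<close> gives \<open>a (j k) \<ge> (w k / L (j k))^j\<close> (\<open>solution_coeff_ge_power\<close>). With \<open>n = j k\<close> and
  \<open>y = log L n\<close> the exponent on the right is \<open>- (n / k) (k^(1/\<kappa>) + y)\<close>, and \<open>k \<approx> y^\<kappa>\<close> balances the two
  terms to \<open>a n \<ge> exp (- O (n y^(1-\<kappa>)))\<close>. On the other hand \<open>n^m a n\<close> is at most the supremum norm of
  \<open>u^(m)\<close>. The bound to be refuted would therefore force, on optimising in \<open>m\<close>,
  \<open>a n \<le> exp (- c n y^(1-\<kappa>+\<epsilon>))\<close> up to a constant factor, which contradicts the lower bound for large \<open>n\<close>.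
  The comparison is carried out in \<open>solution_coeff_decays_slowly\<close>.
\<close>

section \<open>Fourier series on nonnegative frequencies\<close>

text \<open>
  Only Fourier series supported on nonnegative frequencies occur: multiplication by such a
  series couples the \<open>n\<close>-th coefficient to frequencies up to \<open>n\<close> only. The weights below are what
  is needed to differentiate term by term arbitrarily often.
\<close>

definition rapidly_decreasing :: "(nat \<Rightarrow> complex) \<Rightarrow> bool" where
  "rapidly_decreasing c \<longleftrightarrow> (\<forall>m. summable (\<lambda>n. real n ^ m * norm (c n)))"

definition fourier_series :: "(nat \<Rightarrow> complex) \<Rightarrow> real \<Rightarrow> complex" where
  "fourier_series c x = (\<Sum>n. c n * cis (real n * x))"

lemma rapidly_decreasing_summable:
  "rapidly_decreasing c \<Longrightarrow> summable (\<lambda>n. norm (c n))"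
  unfolding rapidly_decreasing_def by (drule spec[of _ 0]) simp

lemma rapidly_decreasing_deriv:
  assumes "rapidly_decreasing c"
  shows "rapidly_decreasing (\<lambda>n. (\<i> * of_nat n) ^ m * c n)"
  unfolding rapidly_decreasing_def
proof
  fix k
  show "summable (\<lambda>n. real n ^ k * norm ((\<i> * of_nat n) ^ m * c n))"
    using assms[unfolded rapidly_decreasing_def, rule_format, of "k + m"]
    by (simp add: norm_mult norm_power power_add mult_ac)
qed

lemma rapidly_decreasing_if_exp_bound:
  assumes "\<And>n. norm (c n) \<le> M * exp (- (\<delta> * real n))" "\<delta> > 0"
  shows "rapidly_decreasing c"
  unfolding rapidly_decreasing_def
proof
  fix m
  have "summable (\<lambda>n. exp (- (\<delta> / 2)) ^ n)"
    by (rule summable_geometric) (use assms(2) in simp)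
  moreover have "(\<lambda>n. real n ^ m * exp (- (\<delta> * real n))) \<in> O(\<lambda>n. exp (- (\<delta> / 2) * real n))"
    using assms(2) by real_asymp
  moreover have "exp (- (\<delta> / 2)) ^ n = exp (- (\<delta> / 2) * real n)" for n
    by (rule exp_of_nat2_mult[symmetric])
  ultimately have "summable (\<lambda>n. real n ^ m * exp (- (\<delta> * real n)))"
    using summable_comparison_test_bigo[where g = "\<lambda>n. exp (- (\<delta> / 2) * real n)"]
    by (simp only: real_norm_def abs_exp_cancel)
  from summable_mult[OF this, of M]
  show "summable (\<lambda>n. real n ^ m * norm (c n))"
  proof (rule summable_comparison_test'[where N = 0])
    fix n
    show "norm (real n ^ m * norm (c n)) \<le> M * (real n ^ m * exp (- (\<delta> * real n)))"
      using mult_left_mono[OF assms(1)[of n], of "real n ^ m"] by (simp add: mult_ac)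
  qed
qed

lemma fourier_series_sums:
  assumes "rapidly_decreasing c"
  shows "(\<lambda>n. c n * cis (real n * x)) sums fourier_series c x"
proof -
  have "summable (\<lambda>n. norm (c n * cis (real n * x)))"
    using rapidly_decreasing_summable[OF assms] by (simp only: norm_mult norm_cis mult_1_right)
  then show ?thesis
    unfolding fourier_series_def by (rule summable_sums[OF summable_norm_cancel])
qed

lemma norm_fourier_series_le:
  assumes "rapidly_decreasing c"
  shows "norm (fourier_series c x) \<le> (\<Sum>n. norm (c n))"
proof -
  have "summable (\<lambda>n. norm (c n * cis (real n * x)))"
    using rapidly_decreasing_summable[OF assms] by (simp only: norm_mult norm_cis mult_1_right)
  from summable_norm[OF this] show ?thesis
    by (simp only: fourier_series_def norm_mult norm_cis mult_1_right)
qed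

lemma periodic_fourier_series: "periodic_2pi (fourier_series c)"
proof -
  have "cis (real n * (x + 2 * pi)) = cis (real n * x)" for n x
    using cis_multiple_2pi[of "real n"] by (simp add: distrib_left cis_mult[symmetric] mult_ac)
  then show ?thesis by (simp add: periodic_2pi_def fourier_series_def)
qed

lemma has_vector_derivative_fourier_series:
  assumes "rapidly_decreasing c"
  shows "(fourier_series c has_vector_derivative fourier_series (\<lambda>n. \<i> * of_nat n * c n) x) (at x)"
proof -
  let ?d = "\<lambda>n. \<i> * of_nat n * c n"
  have d: "rapidly_decreasing ?d"
    using rapidly_decreasing_deriv[OF assms, of 1] by simp
  have unif: "uniform_limit UNIV (\<lambda>n x. \<Sum>i<n. ?d i * cis (real i * x)) (fourier_series ?d) sequentially"
    unfolding fourier_series_def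
    by (rule Weierstrass_m_test[OF _ rapidly_decreasing_summable[OF d]]) (simp add: norm_mult)
  have "\<exists>g. \<forall>x\<in>UNIV. (\<lambda>n. c n * cis (real n * x)) sums g x \<and>
      (g has_derivative (\<lambda>h. h *\<^sub>R fourier_series ?d x)) (at x within UNIV)"
  proof (rule has_derivative_series)
    show "((\<lambda>x. c n * cis (real n * x)) has_derivative
        (\<lambda>h. h *\<^sub>R (?d n * cis (real n * x)))) (at x within UNIV)" for n x
      unfolding has_vector_derivative_def[symmetric] cis_conv_exp of_real_mult
      by (rule has_vector_derivative_real_field) (auto intro!: derivative_eq_intros)
    show "\<forall>\<^sub>F n in sequentially. \<forall>x\<in>UNIV. \<forall>h.
        norm ((\<Sum>i<n. h *\<^sub>R (?d i * cis (real i * x))) - h *\<^sub>R fourier_series ?d x) \<le> e * norm h"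
      if "e > 0" for e
      using uniform_limitD[OF unif that]
    proof eventually_elim
      case (elim n)
      show ?case
      proof (intro ballI allI)
        fix x h :: real
        have "norm ((\<Sum>i<n. ?d i * cis (real i * x)) - fourier_series ?d x) \<le> e"
          using elim by (auto simp: dist_norm intro: less_imp_le)
        from mult_right_mono[OF this norm_ge_zero[of h]]
        show "norm ((\<Sum>i<n. h *\<^sub>R (?d i * cis (real i * x))) - h *\<^sub>R fourier_series ?d x) \<le> e * norm h"
          unfolding scaleR_sum_right[symmetric] scaleR_diff_right[symmetric]
          by (simp only: norm_scaleR real_norm_def mult.commute)
      qed
    qed
    show "(\<lambda>n. c n * cis (real n * 0)) sums fourier_series c 0"
      by (rule fourier_series_sums[OF assms])
  qed auto
  then obtain g where "\<forall>x\<in>UNIV. (\<lambda>n. c n * cis (real n * x)) sums g x \<and>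
      (g has_derivative (\<lambda>h. h *\<^sub>R fourier_series ?d x)) (at x within UNIV)" ..
  note g = bspec[OF this UNIV_I]
  have "g = fourier_series c"
    by (rule ext) (rule sums_unique2[OF conjunct1[OF g] fourier_series_sums[OF assms]])
  then show ?thesis using conjunct2[OF g] unfolding has_vector_derivative_def by (simp only:)
qed

lemma nth_vderiv_fourier_series:
  assumes "rapidly_decreasing c"
  shows "nth_vderiv m (fourier_series c) = fourier_series (\<lambda>n. (\<i> * of_nat n) ^ m * c n)"
proof (induction m)
  case (Suc m)
  have "vector_derivative (fourier_series (\<lambda>n. (\<i> * of_nat n) ^ m * c n)) (at x) =
      fourier_series (\<lambda>n. (\<i> * of_nat n) ^ Suc m * c n) x" for x
    unfolding power_Suc mult.assoc
    by (rule vector_derivative_at)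
      (rule has_vector_derivative_fourier_series[OF rapidly_decreasing_deriv[OF assms],
         unfolded mult.assoc])
  then show ?case unfolding nth_vderiv.simps Suc by (rule ext)
qed (simp only: nth_vderiv.simps power_0 mult_1_left)

lemma smooth_fourier_series:
  assumes "rapidly_decreasing c"
  shows "smooth (fourier_series c)"
  unfolding smooth_def nth_vderiv_fourier_series[OF assms]
  by (intro allI differentiableI_vector)
    (rule has_vector_derivative_fourier_series[OF rapidly_decreasing_deriv[OF assms]])

lemma continuous_fourier_series:
  assumes "rapidly_decreasing c"
  shows "continuous_on S (fourier_series c)"
  by (intro continuous_at_imp_continuous_on ballI has_vector_derivative_continuous)
    (rule has_vector_derivative_fourier_series[OF assms])

lemma fourier_coeff_character:
  "fourier_coeff (\<lambda>x. cis (real_of_int k * x)) n = (if n = k then 1 else 0)"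
proof (cases "n = k")
  case True
  then show ?thesis by (simp add: fourier_coeff_def cis_mult measure_restrict_space)
next
  case False
  let ?I = "{0..2 * pi}"
  define j where "j = real_of_int (k - n)"
  have j: "j \<noteq> 0" using False by (simp add: j_def)
  let ?F = "\<lambda>x. cis (j * x) / (\<i> * of_real j)"
  have "((\<lambda>x. cis (j * x)) has_integral ?F (2 * pi) - ?F 0) ?I"
    by (rule fundamental_theorem_of_calculus)
      (use j in \<open>auto simp: cis_conv_exp field_simps
         intro!: derivative_eq_intros has_vector_derivative_real_field\<close>)
  moreover have "cis (j * (2 * pi)) = 1"
    using cis_multiple_2pi[of "j"] by (simp add: j_def mult_ac)
  ultimately have "((\<lambda>x. cis (j * x)) has_integral 0) ?I" by simp
  moreover have "integrable (lebesgue_on ?I) (\<lambda>x. cis (j * x))"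
    by (intro continuous_imp_integrable_real continuous_intros)
  ultimately have "(LINT x|lebesgue_on ?I. cis (j * x)) = 0"
    by (simp add: lebesgue_integral_eq_integral integral_unique)
  moreover have "cis (real_of_int k * x) * cis (- (real_of_int n * x)) = cis (j * x)" for x
    by (simp add: cis_mult j_def algebra_simps)
  ultimately show ?thesis using False by (simp add: fourier_coeff_def)
qed

lemma fourier_coeff_fourier_series:
  assumes "rapidly_decreasing c"
  shows "fourier_coeff (fourier_series c) n = (if n \<ge> 0 then c (nat n) else 0)"
proof -
  let ?M = "lebesgue_on {0..2 * pi}"
  let ?f = "\<lambda>k x. c k * cis (real k * x) * cis (- (real_of_int n * x))"
  have fs: "(\<Sum>k. ?f k x) = fourier_series c x * cis (- (real_of_int n * x))" for x
    by (rule sums_unique[symmetric]) (rule sums_mult2[OF fourier_series_sums[OF assms]])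
  have "(\<lambda>k. integral\<^sup>L ?M (?f k)) sums (\<integral>x. (\<Sum>k. ?f k x) \<partial>?M)"
  proof (rule sums_integral)
    show "integrable ?M (?f k)" for k
      by (intro continuous_imp_integrable_real continuous_intros)
    have norm: "norm (?f k x) = norm (c k)" for k x by (simp add: norm_mult)
    show "AE x in ?M. summable (\<lambda>k. norm (?f k x))"
      unfolding norm by (intro AE_I2 rapidly_decreasing_summable[OF assms])
    have "(\<integral>x. norm (?f k x) \<partial>?M) = 2 * pi * norm (c k)" for k
      unfolding norm by (simp add: measure_restrict_space)
    then show "summable (\<lambda>k. \<integral>x. norm (?f k x) \<partial>?M)"
      by (simp only: summable_mult[OF rapidly_decreasing_summable[OF assms]])
  qed
  from sums_scaleR_right[OF this[unfolded fs], of "1 / (2 * pi)"]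
  have "(\<lambda>k. c k * fourier_coeff (\<lambda>x. cis (real_of_int (int k) * x)) n) sums fourier_coeff (fourier_series c) n"
    by (simp add: fourier_coeff_def mult.assoc)
  then have *: "(\<lambda>k. if k = nat n \<and> n \<ge> 0 then c k else 0) sums fourier_coeff (fourier_series c) n"
    unfolding fourier_coeff_character by (rule sums_cong[THEN iffD1, rotated]) auto
  show ?thesis
    using sums_unique2[OF * ] sums_single[of "nat n" c] by (cases "n \<ge> 0") auto
qed

lemma Linf_norm_fourier_series_le:
  assumes "rapidly_decreasing c"
  shows "Linf_norm (fourier_series c) \<le> ereal (\<Sum>n. norm (c n))"
  unfolding Linf_norm_def
proof (rule esssup_I)
  have "continuous_on {0..2 * pi} (\<lambda>x. norm (fourier_series c x))"
    by (intro continuous_intros continuous_fourier_series assms)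
  then show "(\<lambda>x. ereal (norm (fourier_series c x))) \<in> borel_measurable (lebesgue_on {0..2 * pi})"
    by (intro borel_measurable_ereal continuous_imp_measurable_on_sets_lebesgue) auto
qed (simp add: norm_fourier_series_le[OF assms])

text \<open>
  This is how a single Fourier coefficient of a derivative refutes a bound on its essential
  supremum.
\<close>

lemma norm_fourier_coeff_le_Linf_norm:
  assumes "f absolutely_integrable_on {0..2 * pi}" "Linf_norm f \<le> ereal b"
  shows "norm (fourier_coeff f n) \<le> b"
proof -
  let ?M = "lebesgue_on {0..2 * pi}"
  have int: "integrable ?M f"
    using assms(1) by (simp add: absolutely_integrable_imp_integrable)
  have b: "AE x in ?M. norm (f x) \<le> b"
    using esssup_AE[of "\<lambda>x. ereal (norm (f x))" ?M]
  proof eventually_elim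
    case (elim x)
    then have "ereal (norm (f x)) \<le> ereal b"
      using assms(2) unfolding Linf_norm_def by (rule order_trans)
    then show ?case by simp
  qed
  have "norm (LINT x|?M. f x * cis (- (real_of_int n * x)))
      \<le> (LINT x|?M. norm (f x * cis (- (real_of_int n * x))))"
    by (rule integral_norm_bound)
  also have "\<dots> = (LINT x|?M. norm (f x))" by (simp add: norm_mult)
  also have "\<dots> \<le> (LINT x|?M. b)"
    by (rule integral_mono_AE) (use int b in auto)
  also have "\<dots> = 2 * pi * b" by (simp add: measure_restrict_space)
  finally show ?thesis by (simp add: fourier_coeff_def field_simps)
qed

lemma fourier_series_mult:
  assumes "rapidly_decreasing c" "rapidly_decreasing d"
  shows "fourier_series c x * fourier_series d x = fourier_series (\<lambda>n. \<Sum>i\<le>n. c i * d (n - i)) x"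
proof -
  have "(\<lambda>n. \<Sum>i\<le>n. (c i * cis (real i * x)) * (d (n - i) * cis (real (n - i) * x))) sums
      (fourier_series c x * fourier_series d x)"
    unfolding fourier_series_def
    by (rule Cauchy_product_sums)
      (use assms[THEN rapidly_decreasing_summable] in \<open>simp_all add: norm_mult\<close>)
  moreover have "(\<Sum>i\<le>n. (c i * cis (real i * x)) * (d (n - i) * cis (real (n - i) * x))) =
      (\<Sum>i\<le>n. c i * d (n - i)) * cis (real n * x)" for n
    unfolding sum_distrib_right
  proof (rule sum.cong[OF refl])
    fix i assume "i \<in> {..n}"
    then have "cis (real i * x) * cis (real (n - i) * x) = cis (real n * x)"
      by (simp add: cis_mult algebra_simps of_nat_diff)
    then show "(c i * cis (real i * x)) * (d (n - i) * cis (real (n - i) * x)) =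
        c i * d (n - i) * cis (real n * x)"
      by (metis (no_types, opaque_lifting) mult.assoc mult.left_commute)
  qed
  ultimately show ?thesis by (simp add: fourier_series_def sums_iff)
qed

section \<open>The coefficients of the potential\<close>

text \<open>
  For \<open>\<kappa> > 0\<close> the rate \<open>exp (- k^(1/\<kappa>))\<close> is that of a Gevrey function of order \<open>\<kappa>\<close>, since the maximum over \<open>k\<close>
  of \<open>k^m exp (- k^(1/\<kappa>))\<close> is comparable to \<open>(m!)^\<kappa>\<close> up to a geometric factor. For \<open>\<kappa> = 0\<close> it
  degenerates to a cut-off at frequency one. Division by zero makes the exponent \<open>1 / \<kappa>\<close> equal to
  \<open>0\<close> then, so that the coefficient at frequency one is \<open>exp (- 1)\<close>; and \<open>0 powr a = 0\<close>
  gives the value \<open>1\<close> at frequency zero for every \<open>\<kappa>\<close>.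
\<close>

definition gevrey_coeff :: "real \<Rightarrow> nat \<Rightarrow> real" where
  "gevrey_coeff \<kappa> k = (if \<kappa> = 0 \<and> 1 < k then 0 else exp (- (real k powr (1 / \<kappa>))))"

lemma gevrey_coeff_0 [simp]: "gevrey_coeff \<kappa> 0 = 1"
  by (simp add: gevrey_coeff_def)

lemma gevrey_coeff_nonneg [simp]: "gevrey_coeff \<kappa> k \<ge> 0"
  by (simp add: gevrey_coeff_def)

lemma power_le_fact_exp:
  fixes t :: real
  assumes "t \<ge> 0"
  shows "t ^ m \<le> fact m * exp t"
proof -
  have "(\<Sum>n\<in>{m}. t ^ n /\<^sub>R fact n) \<le> (\<Sum>n. t ^ n /\<^sub>R fact n)"
    by (rule sum_le_suminf) (use assms summable_exp_generic[of t] in auto)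
  then show ?thesis by (simp add: exp_def field_simps)
qed

text \<open>
  With \<open>t = k^(1/\<kappa>)\<close> one has \<open>k^m = (t^m)^\<kappa> \<le> (m! e^t)^\<kappa>\<close>. Multiplying by \<open>e^(-t)\<close> leaves
  \<open>(m!)^\<kappa> exp (- (1 - \<kappa>) t)\<close>, and \<open>t \<ge> k\<close> because \<open>\<kappa> < 1\<close>. The right-hand side is summable in \<open>k\<close>,
  with a sum that depends on \<open>m\<close> only through \<open>(m!)^\<kappa>\<close>.
\<close>

lemma power_gevrey_coeff_le:
  assumes "0 \<le> \<kappa>" "\<kappa> < 1"
  shows "real k ^ m * gevrey_coeff \<kappa> k \<le> fact m powr \<kappa> * exp (- ((1 - \<kappa>) * real k))"
proof -
  have fact: "1 \<le> (fact m :: real) powr \<kappa>"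
    using assms by (simp add: ge_one_powr_ge_zero)
  consider "k = 0" | "k \<ge> 1" "\<kappa> = 0" | "k \<ge> 1" "\<kappa> > 0" using assms by linarith
  then show ?thesis
  proof cases
    case 1
    then show ?thesis using fact by (cases m) auto
  next
    case 2
    then show ?thesis by (cases "k = 1") (auto simp: gevrey_coeff_def)
  next
    case 3
    define t where "t = real k powr (1 / \<kappa>)"
    have "real k powr 1 \<le> t"
      unfolding t_def using 3 assms by (intro powr_mono) auto
    then have t: "real k \<le> t" "t > 0" using 3 by auto
    have "real k = t powr \<kappa>" using 3 by (simp add: t_def powr_powr)
    then have "real k ^ m = (t ^ m) powr \<kappa>"
      using t by (simp add: powr_powr powr_realpow[symmetric] mult.commute)
    also have "\<dots> \<le> (fact m * exp t) powr \<kappa>"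
      using t 3 by (intro powr_mono2 power_le_fact_exp) auto
    also have "\<dots> = fact m powr \<kappa> * exp (\<kappa> * t)"
      by (simp add: powr_mult powr_def[of "exp t"])
    finally have "real k ^ m * gevrey_coeff \<kappa> k \<le> fact m powr \<kappa> * exp (\<kappa> * t) * exp (- t)"
      using 3 by (simp add: gevrey_coeff_def t_def mult_right_mono)
    also have "\<dots> = fact m powr \<kappa> * exp (- ((1 - \<kappa>) * t))"
      by (simp add: mult.assoc exp_add[symmetric] algebra_simps)
    also have "\<dots> \<le> fact m powr \<kappa> * exp (- ((1 - \<kappa>) * real k))"
      using t assms by (intro mult_left_mono) (auto intro: mult_left_mono)
    finally show ?thesis .
  qed
qed

section \<open>The coefficients of the solution\<close>

definition log_symbol :: "nat \<Rightarrow> real" where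
  "log_symbol n = ln (exp 1 + real n)"

lemma log_symbol_0 [simp]: "log_symbol 0 = 1"
  by (simp add: log_symbol_def)

lemma log_symbol_mono: "m \<le> n \<Longrightarrow> log_symbol m \<le> log_symbol n"
  by (simp add: log_symbol_def add_pos_nonneg)

lemma log_symbol_gt_1: "n > 0 \<Longrightarrow> log_symbol n > 1"
  unfolding log_symbol_def
  by (subst ln_exp[of 1, symmetric], subst ln_less_cancel_iff) (auto intro: add_pos_pos)

text \<open>
  The equation for the \<open>n\<close>-th coefficient contains the \<open>n\<close>-th unknown on both sides, on the
  right with the factor \<open>w 0 = 1\<close>. Since the symbol equals \<open>1\<close> at frequency zero, the equation
  for \<open>n = 0\<close> is an identity and the constant coefficient is free; all others are then determined.
\<close>

fun solution_coeff :: "(nat \<Rightarrow> real) \<Rightarrow> nat \<Rightarrow> real" where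
  "solution_coeff w n =
     (if n = 0 then 1
      else (\<Sum>i<n. w (n - i) * solution_coeff w i) / (log_symbol n - 1))"

declare solution_coeff.simps [simp del]

lemma solution_coeff_0 [simp]: "solution_coeff w 0 = 1"
  by (simp add: solution_coeff.simps)

lemma log_symbol_solution_coeff:
  assumes "w 0 = 1"
  shows "log_symbol n * solution_coeff w n = (\<Sum>i\<le>n. w i * solution_coeff w (n - i))"
proof -
  have "(\<Sum>i\<le>n. w i * solution_coeff w (n - i)) = (\<Sum>i\<le>n. w (n - i) * solution_coeff w i)"
    using sum.nat_diff_reindex[of "\<lambda>i. w i * solution_coeff w (n - i)" "Suc n"]
    by (simp add: lessThan_Suc_atMost)
  also have "\<dots> = (\<Sum>i<n. w (n - i) * solution_coeff w i) + solution_coeff w n"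
    using assms by (simp add: lessThan_Suc_atMost[symmetric])
  also have "(\<Sum>i<n. w (n - i) * solution_coeff w i) = (log_symbol n - 1) * solution_coeff w n"
    using log_symbol_gt_1[of n] by (cases "n = 0") (simp_all add: solution_coeff.simps[of w n])
  finally show ?thesis by (simp add: algebra_simps)
qed

lemma solution_coeff_nonneg:
  assumes "\<And>k. w k \<ge> 0"
  shows "solution_coeff w n \<ge> 0"
proof (induction n rule: less_induct)
  case (less n)
  have "(\<Sum>i<n. w (n - i) * solution_coeff w i) \<ge> 0"
    by (intro sum_nonneg mult_nonneg_nonneg assms less) auto
  then show ?case using log_symbol_gt_1[of n]
    by (auto simp: solution_coeff.simps[of w n])
qed

text \<open>
  With \<open>q = exp (- \<delta> / 2)\<close> and \<open>a\<close> the solution, the bound \<open>a i \<le> M q^i\<close> for \<open>i < n\<close> gives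
  \<open>(\<Sum>i<n. w (n - i) * a i) \<le> M q^n / (1 - q)\<close>, because \<open>w\<close> decays like \<open>q^(2k)\<close>. As the symbol tends to
  infinity, dividing by it absorbs the factor \<open>1 / (1 - q)\<close> from some \<open>N\<close> on; the
  coefficients up to \<open>N\<close> only determine \<open>M\<close>.
\<close>

lemma solution_coeff_exp_bound:
  assumes w: "\<And>k. 0 \<le> w k" "\<And>k. w k \<le> exp (- (\<delta> * real k))" and \<delta>: "\<delta> > 0"
  shows "\<exists>M. \<forall>n. solution_coeff w n \<le> M * exp (- (\<delta> / 2 * real n))"
proof -
  define q where "q = exp (- (\<delta> / 2))"
  have q: "0 < q" "q < 1" using \<delta> by (auto simp: q_def)
  have q_power: "exp (- (\<delta> / 2 * real n)) = q ^ n" for n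
    by (simp add: q_def exp_of_nat2_mult[symmetric])
  have w_q: "w k \<le> q ^ k * q ^ k" for k
    using w(2)[of k] by (simp add: q_power[symmetric] exp_add[symmetric])
  define S where "S = 1 / (1 - q)"
  have S: "S > 0" using q by (simp add: S_def)
  have "filterlim log_symbol at_top sequentially"
    unfolding log_symbol_def by real_asymp
  then have "eventually (\<lambda>n. log_symbol n \<ge> S + 1) sequentially"
    by (simp add: filterlim_at_top)
  then obtain N where N: "\<And>n. n \<ge> N \<Longrightarrow> log_symbol n \<ge> S + 1"
    by (auto simp: eventually_sequentially)
  define M where "M = (\<Sum>n\<le>N. solution_coeff w n / q ^ n)"
  note nonneg = solution_coeff_nonneg[of w, OF w(1)]
  have M: "M \<ge> 0" unfolding M_def using nonneg q by (intro sum_nonneg) auto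
  have "solution_coeff w n \<le> M * q ^ n" for n
  proof (induction n rule: less_induct)
    case (less n)
    show ?case
    proof (cases "n \<le> N")
      case True
      have "solution_coeff w n / q ^ n \<le> M"
        unfolding M_def by (rule member_le_sum) (use True nonneg q in auto)
      then show ?thesis using q by (simp add: field_simps)
    next
      case False
      have "w (n - i) * solution_coeff w i \<le> M * q ^ n * q ^ (n - i)" if "i < n" for i
      proof -
        have "w (n - i) * solution_coeff w i \<le> (q ^ (n - i) * q ^ (n - i)) * (M * q ^ i)"
          using that by (intro mult_mono w_q less nonneg) (use q in auto)
        also have "\<dots> = M * (q ^ (n - i) * q ^ i) * q ^ (n - i)" by simp
        finally show ?thesis using that by (simp flip: power_add)
      qed
      then have "(\<Sum>i<n. w (n - i) * solution_coeff w i) \<le> (\<Sum>i<n. M * q ^ n * q ^ (n - i))"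
        by (intro sum_mono) auto
      also have "\<dots> = M * q ^ n * (\<Sum>i<n. q ^ Suc i)"
        unfolding sum_distrib_left
        by (subst sum.nat_diff_reindex[symmetric]) (simp add: Suc_diff_Suc del: power_Suc)
      also have "(\<Sum>i<n. q ^ Suc i) \<le> (\<Sum>i<n. q ^ i)"
        using q by (intro sum_mono power_decreasing) auto
      also have "(\<Sum>i<n. q ^ i) \<le> (\<Sum>i. q ^ i)"
        using q by (intro sum_le_suminf summable_geometric) auto
      also have "\<dots> = S" using q by (simp add: S_def suminf_geometric)
      finally have *: "(\<Sum>i<n. w (n - i) * solution_coeff w i) \<le> M * q ^ n * S"
        using M q by (simp add: mult_left_mono)
      have "solution_coeff w n = (\<Sum>i<n. w (n - i) * solution_coeff w i) / (log_symbol n - 1)"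
        using False by (simp add: solution_coeff.simps[of w n])
      also have "\<dots> \<le> M * q ^ n * S / S"
        using N[of n] False S M q by (intro frac_le *) auto
      finally show ?thesis using S by simp
    qed
  qed
  then show ?thesis unfolding q_power by blast
qed

text \<open>
  All terms of the recursion are nonnegative, so it may be bounded below by the single term that
  steps down by \<open>k\<close>. The frequency \<open>j * k\<close> is reached from \<open>0\<close> in \<open>j\<close> such steps.
\<close>

lemma solution_coeff_ge_power:
  assumes w: "\<And>i. w i \<ge> 0" and "k > 0" and "log_symbol (j * k) \<le> \<Lambda>"
  shows "(w k / \<Lambda>) ^ j \<le> solution_coeff w (j * k)"
  using assms(3)
proof (induction j)
  case (Suc j)
  let ?n = "Suc j * k"
  have n: "?n > 0" "j * k < ?n" using \<open>k > 0\<close> by auto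
  have \<Lambda>: "\<Lambda> > 1" using log_symbol_gt_1[OF n(1)] Suc.prems by simp
  note nonneg = solution_coeff_nonneg[of w, OF w]
  have "log_symbol (j * k) \<le> \<Lambda>"
    using Suc.prems log_symbol_mono[of "j * k" ?n] n by linarith
  then have "(w k / \<Lambda>) ^ Suc j \<le> w k / \<Lambda> * solution_coeff w (j * k)"
    unfolding power_Suc using Suc.IH w[of k] \<Lambda> by (intro mult_left_mono) auto
  also have "\<dots> = w (?n - j * k) * solution_coeff w (j * k) / \<Lambda>"
    by simp
  also have "\<dots> \<le> (\<Sum>i<?n. w (?n - i) * solution_coeff w i) / (log_symbol ?n - 1)"
  proof (rule frac_le)
    show "w (?n - j * k) * solution_coeff w (j * k) \<le> (\<Sum>i<?n. w (?n - i) * solution_coeff w i)"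
      by (rule member_le_sum[of "j * k" _ "\<lambda>i. w (?n - i) * solution_coeff w i"])
        (use n w nonneg in auto)
  qed (use w nonneg Suc.prems log_symbol_gt_1[OF n(1)] in \<open>auto intro: sum_nonneg\<close>)
  also have "\<dots> = solution_coeff w ?n" using n by (subst solution_coeff.simps[of w ?n]) simp
  finally show ?case .
qed simp

section \<open>Slow decay of the solution\<close>

definition loglog :: "real \<Rightarrow> real" where
  "loglog x = ln (exp 1 + ln (exp 1 + x))"

lemma loglog_ge_1: "x \<ge> 0 \<Longrightarrow> loglog x \<ge> 1"
proof -
  assume "x \<ge> 0"
  then have "ln (exp 1) \<le> ln (exp 1 + x)" by (subst ln_le_cancel_iff) (auto intro: add_pos_nonneg)
  then have "ln (exp 1) \<le> ln (exp 1 + ln (exp 1 + x))"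
    by (subst ln_le_cancel_iff) (auto intro: add_pos_nonneg)
  then show ?thesis by (simp add: loglog_def)
qed

lemma log_symbol_le_exp_loglog: "log_symbol m \<le> exp (loglog (real m))"
proof -
  have "0 < exp 1 + ln (exp 1 + real m)"
    using log_symbol_mono[of 0 m] by (intro add_pos_nonneg) (simp_all add: log_symbol_def)
  then show ?thesis by (simp add: log_symbol_def loglog_def)
qed

lemma eventually_loglog_small:
  fixes a b c p \<epsilon> :: real
  assumes "p > 0" "\<epsilon> > 0"
  shows "eventually (\<lambda>m. a * real m / loglog (real m) powr p + 2 * loglog (real m) \<le> real m) sequentially"
    and "eventually (\<lambda>m. c + a * real m * loglog (real m) powr (- \<epsilon>) + b * loglog (real m) < real m) sequentially"
proof -
  have 1: "(\<lambda>m. (a * real m / loglog (real m) powr p + 2 * loglog (real m)) / real m) \<longlonglongrightarrow> 0"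
    unfolding loglog_def using assms by real_asymp
  have 2: "(\<lambda>m. (c + a * real m * loglog (real m) powr (- \<epsilon>) + b * loglog (real m)) / real m) \<longlonglongrightarrow> 0"
    unfolding loglog_def using assms by real_asymp
  show "eventually (\<lambda>m. a * real m / loglog (real m) powr p + 2 * loglog (real m) \<le> real m) sequentially"
    using order_tendstoD(2)[OF 1 zero_less_one] eventually_gt_at_top[of "0::nat"]
    by eventually_elim (simp add: field_simps)
  show "eventually (\<lambda>m. c + a * real m * loglog (real m) powr (- \<epsilon>) + b * loglog (real m) < real m) sequentially"
    using order_tendstoD(2)[OF 2 zero_less_one] eventually_gt_at_top[of "0::nat"]
    by eventually_elim (simp add: field_simps)
qed

text \<open>
  The step length \<open>k \<approx> y^\<kappa>\<close> is chosen so that the loss \<open>exp (- k^(1/\<kappa>))\<close> is comparable to \<open>e^(-y)\<close>.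
  For \<open>\<kappa> = 0\<close> it is exactly \<open>k = 1\<close>, where the coefficient does not vanish.
\<close>

lemma gevrey_coeff_ge_exp:
  assumes "0 \<le> \<kappa>" "y \<ge> 1"
  shows "gevrey_coeff \<kappa> (nat \<lceil>y powr \<kappa>\<rceil>) \<ge> exp (- (2 powr (1 / \<kappa>) * y))"
proof -
  let ?k = "nat \<lceil>y powr \<kappa>\<rceil>"
  have y: "1 \<le> y powr \<kappa>" using assms by (simp add: ge_one_powr_ge_zero)
  then have k: "real ?k \<le> 2 * y powr \<kappa>" by linarith
  have "real ?k powr (1 / \<kappa>) \<le> (2 * y powr \<kappa>) powr (1 / \<kappa>)"
    using assms k y by (intro powr_mono2) simp_all
  also have "\<dots> = 2 powr (1 / \<kappa>) * y powr (\<kappa> * (1 / \<kappa>))"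
    using assms by (simp add: powr_mult powr_powr)
  also have "y powr (\<kappa> * (1 / \<kappa>)) \<le> y" using assms by (cases "\<kappa> = 0") auto
  finally have "real ?k powr (1 / \<kappa>) \<le> 2 powr (1 / \<kappa>) * y" by simp
  moreover have "\<not> (\<kappa> = 0 \<and> 1 < ?k)" using assms by auto
  ultimately show ?thesis by (simp add: gevrey_coeff_def)
qed

text \<open>
  Write \<open>y\<close> for the iterated logarithm of \<open>m\<close> and \<open>p = 1 - \<kappa> + \<epsilon>\<close>. The quotient of the two sides
  is governed by \<open>(B m / (n y^p))^m\<close>, which drops to \<open>e^(-m)\<close> at \<open>n \<approx> e B m / y^p\<close>. A step of length
  \<open>k \<approx> y^\<kappa>\<close> multiplies the lower bound by at least \<open>exp (- D y)\<close>: one part from the potential, one from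
  the symbol, which is at most \<open>e^y\<close> as long as \<open>n \<le> m\<close>. Reaching \<open>n\<close> takes \<open>n / k\<close> steps and
  contributes \<open>exp (- O (n y^(1-\<kappa>))) = exp (- O (m y^(-\<epsilon>)))\<close>. Since \<open>y\<close> tends to infinity, this exceeds
  \<open>C e^(-m)\<close> for large \<open>m\<close>.
\<close>

lemma solution_coeff_decays_slowly:
  fixes \<kappa> \<epsilon> B C :: real
  assumes \<kappa>: "0 \<le> \<kappa>" "\<kappa> < 1" and \<epsilon>: "\<epsilon> > 0" and B: "B > 0" and C: "C > 0"
  shows "\<exists>m n. C * B ^ m * (real m ^ m / loglog (real m) powr ((1 - \<kappa> + \<epsilon>) * real m))
      < real n ^ m * solution_coeff (gevrey_coeff \<kappa>) n"
proof -
  define p where "p = 1 - \<kappa> + \<epsilon>"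
  define D where "D = 2 powr (1 / \<kappa>) + 1"
  have D: "D > 0" by (simp add: D_def add_pos_pos)
  have p: "p > 0" using \<kappa> \<epsilon> by (simp add: p_def)
  have "eventually (\<lambda>m. m > 0 \<and>
      exp 1 * B * real m / loglog (real m) powr p + 2 * loglog (real m) \<le> real m \<and>
      ln C + D * exp 1 * B * real m * loglog (real m) powr (- \<epsilon>) + D * loglog (real m) < real m) sequentially"
    using eventually_loglog_small[OF p \<epsilon>] by (intro eventually_conj eventually_gt_at_top)
  then obtain m where m: "m > 0"
    and small1: "exp 1 * B * real m / loglog (real m) powr p + 2 * loglog (real m) \<le> real m"
    and small2: "ln C + D * exp 1 * B * real m * loglog (real m) powr (- \<epsilon>) + D * loglog (real m) < real m"
    by (auto simp: eventually_sequentially)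
  define y where "y = loglog (real m)"
  have y: "y \<ge> 1" by (simp add: y_def loglog_ge_1)
  define k where "k = nat \<lceil>y powr \<kappa>\<rceil>"
  have y\<kappa>: "1 \<le> y powr \<kappa>" "y powr \<kappa> \<le> y"
    using y \<kappa> powr_mono[of \<kappa> 1 y] by (simp_all add: ge_one_powr_ge_zero)
  have k: "y powr \<kappa> \<le> real k" "real k \<le> 2 * y" "k > 0"
    using y\<kappa> unfolding k_def by linarith+
  \<comment> \<open>The real number of steps that would reach \<open>n = e B m / y^p\<close> exactly; \<open>j\<close> rounds it up.\<close>
  define E where "E = exp 1 * B * real m / (y powr p * real k)"
  have E: "E > 0" unfolding E_def using m y k B by simp
  define j where "j = nat \<lceil>E\<rceil>"
  have j: "E \<le> real j" "real j \<le> E + 1" "j > 0" unfolding j_def using E by linarith+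
  have Ek: "E * real k = exp 1 * B * real m / y powr p" using k by (simp add: E_def)
  have n_ge: "exp 1 * B * real m / y powr p \<le> real (j * k)"
    unfolding Ek[symmetric] using j by (simp add: mult_right_mono)
  \<comment> \<open>Rounding up overshoots by at most one step, which keeps \<open>n = j * k\<close> below \<open>m\<close>.\<close>
  have "real (j * k) \<le> E * real k + real k"
    using mult_right_mono[OF j(2), of "real k"] by (simp add: algebra_simps)
  also have "\<dots> \<le> real m" using small1 k unfolding Ek y_def by linarith
  finally have "j * k \<le> m" by linarith
  then have \<Lambda>: "log_symbol (j * k) \<le> exp y"
    unfolding y_def by (rule order_trans[OF log_symbol_mono log_symbol_le_exp_loglog])
  have "y * E \<le> exp 1 * B * real m * y powr (- \<epsilon>)"
  proof -
    have "y * E \<le> y * (exp 1 * B * real m / (y powr p * y powr \<kappa>))"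
      unfolding E_def using y k B by (intro mult_left_mono divide_left_mono) auto
    also have "y powr p * y powr \<kappa> = y powr 1 * y powr \<epsilon>"
    proof -
      have "p + \<kappa> = 1 + \<epsilon>" by (simp add: p_def)
      then show ?thesis unfolding powr_add[symmetric] by (simp only:)
    qed
    also have "y * (exp 1 * B * real m / (y powr 1 * y powr \<epsilon>)) = exp 1 * B * real m * y powr (- \<epsilon>)"
      using y by (simp add: powr_minus field_simps)
    finally show ?thesis .
  qed
  then have "D * (y * E) \<le> D * (exp 1 * B * real m * y powr (- \<epsilon>))"
    using D by (intro mult_left_mono) auto
  moreover have "D * y * real j \<le> D * (y * E) + D * y"
    using mult_left_mono[OF j(2), of "D * y"] D y by (simp add: algebra_simps)
  ultimately have "ln C - real m < - (D * y * real j)"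
    using small2 unfolding y_def by (simp add: mult.assoc)
  then have "exp (ln C - real m) < exp (- (D * y * real j))" by simp
  also have "\<dots> = exp (- (D * y)) ^ j"
    by (simp add: exp_of_nat2_mult[symmetric])
  also have "exp (- (D * y)) = exp (- (2 powr (1 / \<kappa>) * y)) / exp y"
    by (simp add: D_def exp_diff[symmetric] algebra_simps)
  also have "\<dots> ^ j \<le> (gevrey_coeff \<kappa> k / exp y) ^ j"
    unfolding k_def using gevrey_coeff_ge_exp[OF \<kappa>(1) y] by (intro power_mono divide_right_mono) auto
  also have "\<dots> \<le> solution_coeff (gevrey_coeff \<kappa>) (j * k)"
    by (rule solution_coeff_ge_power) (use k \<Lambda> in auto)
  finally have lower: "C * exp (- real m) < solution_coeff (gevrey_coeff \<kappa>) (j * k)"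
    using C by (simp add: exp_diff exp_minus divide_inverse)
  have "C * B ^ m * (real m ^ m / y powr (p * real m)) = C * (B * real m / y powr p) ^ m"
    using y by (simp add: power_divide power_mult_distrib powr_powr[symmetric] powr_realpow)
  also have "\<dots> \<le> C * (exp (- 1) * real (j * k)) ^ m"
  proof -
    have "B * real m / y powr p \<le> exp (- 1) * real (j * k)"
      using mult_left_mono[OF n_ge, of "exp (- 1)"] by (simp add: exp_minus field_simps)
    then show ?thesis using C B by (intro mult_left_mono power_mono) auto
  qed
  also have "\<dots> = real (j * k) ^ m * (C * exp (- real m))"
    by (simp add: power_mult_distrib exp_of_nat2_mult[of "-1", symmetric])
  also have "\<dots> < real (j * k) ^ m * solution_coeff (gevrey_coeff \<kappa>) (j * k)"
    using j k by (intro mult_strict_left_mono lower) auto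
  finally show ?thesis unfolding y_def p_def by blast
qed

section \<open>The potential and the solution\<close>

text \<open>
  Coefficientwise the equation is the convolution hypothesis. What remains is that the
  right-hand side is again rapidly decreasing, so that its Fourier coefficients can be read off;
  this follows from the form given by the left-hand side, because the symbol grows at most linearly.
\<close>

lemma log_D_eq_fourier_series:
  assumes c: "rapidly_decreasing c" and d: "rapidly_decreasing d"
    and eq: "\<And>n. of_real (log_symbol n) * c n = (\<Sum>i\<le>n. d i * c (n - i))"
  shows "log_D_eq (fourier_series c) (\<lambda>x. fourier_series d x * fourier_series c x)"
proof -
  let ?p = "\<lambda>n. of_real (log_symbol n) * c n"
  have prod: "fourier_series d x * fourier_series c x = fourier_series ?p x" for x
    using fourier_series_mult[OF d c] by (simp add: eq)
  have p: "rapidly_decreasing ?p"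
    unfolding rapidly_decreasing_def
  proof
    fix m
    have "summable (\<lambda>n. exp 1 * (real n ^ m * norm (c n)) + real n ^ Suc m * norm (c n))"
      using c unfolding rapidly_decreasing_def by (intro summable_add summable_mult) blast+
    then show "summable (\<lambda>n. real n ^ m * norm (?p n))"
    proof (rule summable_comparison_test'[where N = 0])
      fix n
      have "\<bar>log_symbol n\<bar> \<le> exp 1 + real n"
        using ln_le_minus_one[of "exp 1 + real n"] log_symbol_mono[of 0 n]
        by (simp add: log_symbol_def add_pos_nonneg)
      then have "real n ^ m * norm (c n) * \<bar>log_symbol n\<bar> \<le> real n ^ m * norm (c n) * (exp 1 + real n)"
        by (intro mult_left_mono) auto
      then show "norm (real n ^ m * norm (?p n)) \<le>
          exp 1 * (real n ^ m * norm (c n)) + real n ^ Suc m * norm (c n)"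
        by (simp add: norm_mult algebra_simps)
    qed
  qed
  have "of_real (ln (exp 1 + \<bar>real_of_int n\<bar>)) * fourier_coeff (fourier_series c) n =
      fourier_coeff (fourier_series ?p) n" for n
    unfolding fourier_coeff_fourier_series[OF c] fourier_coeff_fourier_series[OF p]
    by (auto simp: log_symbol_def)
  then show ?thesis
    unfolding log_D_eq_def prod
    by (intro conjI allI absolutely_integrable_continuous_real continuous_fourier_series c p) auto
qed

theorem proposition4p2:
  fixes \<kappa> \<epsilon> :: real
  assumes "0 \<le> \<kappa>" and "\<kappa> < 1" and "\<epsilon> > 0"
  shows "\<exists>V u :: real \<Rightarrow> complex.
    periodic_2pi V \<and> smooth V \<and>
    periodic_2pi u \<and> smooth u \<and> bounded (range u) \<and> (\<exists>x. u x \<noteq> 0) \<and>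
    log_D_eq u (\<lambda>x. V x * u x) \<and>
    (\<exists>C>0. \<exists>A>0. \<forall>m.
       Linf_norm (nth_vderiv m V) \<le> ereal (C * A ^ m * (fact m) powr \<kappa>)) \<and>
    \<not> (\<exists>B C1 :: real. \<forall>m.
       Linf_norm (nth_vderiv m u) \<le>
         ereal (C1 * B ^ m *
           (fact m / ln (exp 1 + ln (exp 1 + real m)) powr ((1 - \<kappa> + \<epsilon>) * real m))))"
proof -
  let ?w = "gevrey_coeff \<kappa>"
  let ?a = "solution_coeff ?w"
  define w a where "w n = complex_of_real (?w n)" and "a n = complex_of_real (?a n)" for n
  have w_exp: "?w k \<le> exp (- ((1 - \<kappa>) * real k))" for k
    using power_gevrey_coeff_le[OF assms(1,2), of k 0] by simp
  have a_nonneg: "?a n \<ge> 0" for n by (rule solution_coeff_nonneg) simp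
  have norm_w: "norm (w n) = ?w n" and norm_a: "norm (a n) = ?a n" for n
    using a_nonneg by (simp_all add: w_def a_def)
  have w: "rapidly_decreasing w"
    by (rule rapidly_decreasing_if_exp_bound[where M = 1 and \<delta> = "1 - \<kappa>"])
      (use w_exp assms in \<open>auto simp: norm_w\<close>)
  obtain M where M: "\<And>n. ?a n \<le> M * exp (- ((1 - \<kappa>) / 2 * real n))"
    using solution_coeff_exp_bound[of ?w "1 - \<kappa>"] w_exp assms(2) by auto
  have a: "rapidly_decreasing a"
    by (rule rapidly_decreasing_if_exp_bound[where M = M and \<delta> = "(1 - \<kappa>) / 2"])
      (use M assms in \<open>auto simp: norm_a\<close>)
  let ?V = "fourier_series w" and ?u = "fourier_series a"
  have eq: "log_D_eq ?u (\<lambda>x. ?V x * ?u x)"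
  proof (rule log_D_eq_fourier_series[OF a w])
    show "of_real (log_symbol n) * a n = (\<Sum>i\<le>n. w i * a (n - i))" for n
      unfolding w_def a_def of_real_mult[symmetric] of_real_sum[symmetric]
      by (simp only: log_symbol_solution_coeff[of ?w, OF gevrey_coeff_0])
  qed
  have bdd: "bounded (range ?u)"
    using norm_fourier_series_le[OF a] by (auto simp: bounded_iff)
  have nz: "\<exists>x. ?u x \<noteq> 0"
  proof (rule ccontr)
    assume "\<not> ?thesis"
    \<comment> \<open>The constant coefficient of the solution is \<open>1\<close>.\<close>
    then have "fourier_coeff ?u 0 = 0" by (simp add: fourier_coeff_def)
    then show False by (simp add: fourier_coeff_fourier_series[OF a] a_def)
  qed
  define C where "C = (\<Sum>n. exp (- ((1 - \<kappa>) * real n)))"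
  have sum_exp: "summable (\<lambda>n. exp (- ((1 - \<kappa>) * real n)))"
    using summable_geometric[of "exp (- (1 - \<kappa>))"] assms
    unfolding exp_of_nat2_mult[symmetric] mult_minus_left by simp
  have "C > 0" unfolding C_def by (rule suminf_pos[OF sum_exp]) simp
  have V_gevrey: "Linf_norm (nth_vderiv m ?V) \<le> ereal (C * 1 ^ m * fact m powr \<kappa>)" for m
  proof -
    note dw = rapidly_decreasing_deriv[OF w, of m]
    have "(\<Sum>n. norm ((\<i> * of_nat n) ^ m * w n)) \<le> (\<Sum>n. fact m powr \<kappa> * exp (- ((1 - \<kappa>) * real n)))"
      by (intro suminf_le rapidly_decreasing_summable[OF dw] summable_mult sum_exp)
        (use power_gevrey_coeff_le[OF assms(1,2)] in \<open>simp add: norm_mult norm_power norm_w\<close>)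
    also have "\<dots> = C * 1 ^ m * fact m powr \<kappa>"
      using suminf_mult[OF sum_exp] by (simp add: C_def)
    finally show ?thesis
      unfolding nth_vderiv_fourier_series[OF w]
      using Linf_norm_fourier_series_le[OF dw] by (meson ereal_less_eq(3) order_trans)
  qed
  have no_bound: False
    if *: "\<And>m. Linf_norm (nth_vderiv m ?u) \<le> ereal (C1 * B ^ m *
          (fact m / ln (exp 1 + ln (exp 1 + real m)) powr ((1 - \<kappa> + \<epsilon>) * real m)))" for B C1
  proof -
    have "\<bar>B\<bar> + 1 > 0" "\<bar>C1\<bar> + 1 > 0" by simp_all
    from solution_coeff_decays_slowly[OF assms this] obtain m n where mn: "(\<bar>C1\<bar> + 1) * (\<bar>B\<bar> + 1) ^ m *
        (real m ^ m / loglog (real m) powr ((1 - \<kappa> + \<epsilon>) * real m)) < real n ^ m * ?a n"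
      by blast
    let ?q = "loglog (real m) powr ((1 - \<kappa> + \<epsilon>) * real m)"
    have "real n ^ m * ?a n = norm (fourier_coeff (nth_vderiv m ?u) (int n))"
      using a_nonneg unfolding nth_vderiv_fourier_series[OF a]
      by (simp add: fourier_coeff_fourier_series[OF rapidly_decreasing_deriv[OF a]]
          norm_mult norm_power norm_a)
    also have "\<dots> \<le> C1 * B ^ m * (fact m / ?q)"
    proof (rule norm_fourier_coeff_le_Linf_norm)
      show "nth_vderiv m ?u absolutely_integrable_on {0..2 * pi}"
        unfolding nth_vderiv_fourier_series[OF a]
        by (intro absolutely_integrable_continuous_real continuous_fourier_series
            rapidly_decreasing_deriv a)
    qed (use *[of m] in \<open>simp add: loglog_def\<close>)
    also have "\<dots> \<le> (\<bar>C1\<bar> * \<bar>B\<bar> ^ m) * (fact m / ?q)"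
      by (intro mult_right_mono) (auto simp: abs_mult[symmetric] power_abs[symmetric])
    also have "\<dots> \<le> (\<bar>C1\<bar> + 1) * (\<bar>B\<bar> + 1) ^ m * (real m ^ m / ?q)"
      using fact_le_power[of m, where ?'a = real]
      by (intro mult_mono power_mono divide_right_mono) auto
    finally show False using mn by simp
  qed
  have "\<exists>C>0. \<exists>A>0. \<forall>m. Linf_norm (nth_vderiv m ?V) \<le> ereal (C * A ^ m * fact m powr \<kappa>)"
    by (intro exI[of _ C] exI[of _ "1::real"] conjI allI V_gevrey \<open>C > 0\<close> zero_less_one)
  moreover have "\<not> (\<exists>B C1 :: real. \<forall>m. Linf_norm (nth_vderiv m ?u) \<le> ereal (C1 * B ^ m *
      (fact m / ln (exp 1 + ln (exp 1 + real m)) powr ((1 - \<kappa> + \<epsilon>) * real m))))"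
    using no_bound by blast
  ultimately have "periodic_2pi ?V \<and> smooth ?V \<and>
      periodic_2pi ?u \<and> smooth ?u \<and> bounded (range ?u) \<and> (\<exists>x. ?u x \<noteq> 0) \<and>
      log_D_eq ?u (\<lambda>x. ?V x * ?u x) \<and>
      (\<exists>C>0. \<exists>A>0. \<forall>m. Linf_norm (nth_vderiv m ?V) \<le> ereal (C * A ^ m * fact m powr \<kappa>)) \<and>
      \<not> (\<exists>B C1 :: real. \<forall>m. Linf_norm (nth_vderiv m ?u) \<le> ereal (C1 * B ^ m *
        (fact m / ln (exp 1 + ln (exp 1 + real m)) powr ((1 - \<kappa> + \<epsilon>) * real m))))"
    by (intro conjI periodic_fourier_series smooth_fourier_series w a bdd nz eq)
  then show ?thesis by (intro exI)
qed

end
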